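(* To every 3-triad cycle in a Cayley-Dickson algebra $\mathbb A_n$ ($n\ge 3$) associate the word in the letters A, B, C, X consisting of the non-associativity types of its first, second and third triads. Of the $64$ possible words, only the following occur: AAA, ACC, XBB, BBA, BXC, CAB, CCX and XXX. That is, every 3-triad cycle in every $\mathbb A_n$ has one of these eight words, and each of these eight words is realised by some 3-triad cycle in some $\mathbb A_n$.
   Context: The real algebras $\mathbb A_n$ are defined recursively: $\mathbb A_0=\mathbb R$ with trivial conjugation, and $\mathbb A_n=\mathbb A_{n-1}\oplus\mathbb A_{n-1}$ with $(x,y)(z,w)=(xz-w^*y,\; wx+yz^* )$ and $(x,y)^*=(x^*,-y)$. The graded basis of $\mathbb A_n$ is $\{\mathrm o_\alpha:\alpha\subseteq\{1,\dots,n\}\}$, with $\mathrm o_\emptyset=1$ and, for $\alpha\subseteq\{1,\dots,n-1\}$, $\mathrm o_\alpha=(\mathrm o_\alpha,0)$ and $\mathrm o_{\alpha\cup\{n\}}=(0,\mathrm o_\alpha)$. Pure basis elements are those with $\alpha\neq\emptyset$. The product of two basis elements is, up to sign, a basis element. The natural order on basis elements is: $\mathrm o_\alpha<\mathrm o_\beta$ iff $\alpha\ne\beta$ and the largest element of the symmetric difference of $\alpha$ and $\beta$ lies in $\beta$. A triad is a triple $(b,c,d)$ of pure basis elements with $b<c<d$. The associator is $[x,y,z]=(xy)z-x(yz)$. For a triad $(b,c,d)$, the Type 1, Type 2 and Type 3 associators are respectively $[b,d,c]$, $[b,c,d]$ and $[c,b,d]$. A non-associative triad (one for which $[b,d,c]-[d,c,b]+[c,b,d]\neq0$)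 has non-associativity type: A if only the Type 1 associator is non-zero; B if only the Type 2 associator is non-zero; C if only the Type 3 associator is non-zero; X if all three are non-zero. A 3-triad cycle consists of the three triads $(b,c,d)$, $(b,bc,d)$, $(c,bc,d)$ (called first, second and third), where $b<c<bc<d$ and $bc$ is read as a basis element, i.e. up to sign (the sign does not affect which associators vanish). *)

theory Defs
  imports Complex_Main
begin

text \<open>
  The Cayley-Dickson algebras as full binary trees of reals: an element of the algebra of index
  \<open>Suc n\<close> is \<open>Pr x y\<close> with \<open>x\<close> and \<open>y\<close> in the algebra of index \<open>n\<close>. Operations on two
  trees of different shape are outside every algebra and have an arbitrary value.
\<close>

datatype cd = Re real | Pr cd cd

primrec cd_algebra :: "nat \<Rightarrow> cd set" where
  "cd_algebra 0 = range Re"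
| "cd_algebra (Suc n) = {Pr x y | x y. x \<in> cd_algebra n \<and> y \<in> cd_algebra n}"

primrec cd_zero :: "nat \<Rightarrow> cd" where
  "cd_zero 0 = Re 0"
| "cd_zero (Suc n) = Pr (cd_zero n) (cd_zero n)"

instantiation cd :: "{plus, uminus, minus, times}"
begin

fun plus_cd :: "cd \<Rightarrow> cd \<Rightarrow> cd" where
  "Re a + Re b = Re (a + b)"
| "Pr x y + Pr z w = Pr (x + z) (y + w)"
| "Re a + Pr z w = undefined"
| "Pr x y + Re b = undefined"

primrec uminus_cd :: "cd \<Rightarrow> cd" where
  "- Re a = Re (- a)"
| "- Pr x y = Pr (- x) (- y)"

definition minus_cd :: "cd \<Rightarrow> cd \<Rightarrow> cd" where
  "x - y = x + (- y)" for x y :: cd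

primrec cd_conj :: "cd \<Rightarrow> cd" where
  "cd_conj (Re a) = Re a"
| "cd_conj (Pr x y) = Pr (cd_conj x) (- y)"

lemma size_uminus_cd [simp]: "size (- x) = size x" for x :: cd
  by (induction x) simp_all

lemma size_cd_conj [simp]: "size (cd_conj x) = size x"
  by (induction x) simp_all

function (sequential) times_cd :: "cd \<Rightarrow> cd \<Rightarrow> cd" where
  "Re a * Re b = Re (a * b)"
| "Pr x y * Pr z w = Pr (x * z - cd_conj w * y) (w * x + y * cd_conj z)"
| "Re a * Pr z w = undefined"
| "Pr x y * Re b = undefined"
  by pat_completeness auto
termination
  by (relation "measure (\<lambda>(u, v). size u + size v)") simp_all

instance ..

end

lemma cd_zero_in_algebra: "cd_zero n \<in> cd_algebra n"
  by (induction n) auto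

lemma uminus_in_cd_algebra: "x \<in> cd_algebra n \<Longrightarrow> - x \<in> cd_algebra n"
  by (induction n arbitrary: x) auto

lemma cd_conj_in_cd_algebra: "x \<in> cd_algebra n \<Longrightarrow> cd_conj x \<in> cd_algebra n"
  by (induction n arbitrary: x) (auto simp: uminus_in_cd_algebra)

lemma plus_in_cd_algebra:
  "x \<in> cd_algebra n \<Longrightarrow> y \<in> cd_algebra n \<Longrightarrow> x + y \<in> cd_algebra n"
  by (induction n arbitrary: x y) auto

lemma times_in_cd_algebra:
  "x \<in> cd_algebra n \<Longrightarrow> y \<in> cd_algebra n \<Longrightarrow> x * y \<in> cd_algebra n"
  by (induction n arbitrary: x y)
    (auto simp: minus_cd_def plus_in_cd_algebra uminus_in_cd_algebra cd_conj_in_cd_algebra)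

text \<open>The element \<open>o\<^sub>\<alpha>\<close> of the algebra of index \<open>n\<close>, meaningful for \<open>\<alpha> \<subseteq> {1..n}\<close>.\<close>

primrec cd_basis :: "nat \<Rightarrow> nat set \<Rightarrow> cd" where
  "cd_basis 0 \<alpha> = Re 1"
| "cd_basis (Suc n) \<alpha> =
     (if Suc n \<in> \<alpha> then Pr (cd_zero n) (cd_basis n (\<alpha> - {Suc n}))
      else Pr (cd_basis n \<alpha>) (cd_zero n))"

lemma cd_basis_in_cd_algebra: "cd_basis n \<alpha> \<in> cd_algebra n"
  by (induction n arbitrary: \<alpha>) (auto simp: cd_zero_in_algebra)

definition pure_basis :: "nat \<Rightarrow> cd set" where
  "pure_basis n = {cd_basis n \<alpha> | \<alpha>. \<alpha> \<subseteq> {1..n} \<and> \<alpha> \<noteq> {}}"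

definition basis_less :: "nat \<Rightarrow> cd \<Rightarrow> cd \<Rightarrow> bool" where
  "basis_less n x y \<longleftrightarrow>
     (\<exists>\<alpha> \<beta>. \<alpha> \<subseteq> {1..n} \<and> \<beta> \<subseteq> {1..n} \<and> x = cd_basis n \<alpha> \<and> y = cd_basis n \<beta> \<and>
        \<alpha> \<noteq> \<beta> \<and> Max ((\<alpha> - \<beta>) \<union> (\<beta> - \<alpha>)) \<in> \<beta>)"

definition triad :: "nat \<Rightarrow> cd \<Rightarrow> cd \<Rightarrow> cd \<Rightarrow> bool" where
  "triad n b c d \<longleftrightarrow>
     b \<in> pure_basis n \<and> c \<in> pure_basis n \<and> d \<in> pure_basis n \<and>
     basis_less n b c \<and> basis_less n c d"

definition associator :: "cd \<Rightarrow> cd \<Rightarrow> cd \<Rightarrow> cd" where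
  "associator x y z = (x * y) * z - x * (y * z)"

definition nonassoc_triad :: "nat \<Rightarrow> cd \<Rightarrow> cd \<Rightarrow> cd \<Rightarrow> bool" where
  "nonassoc_triad n b c d \<longleftrightarrow> triad n b c d \<and>
     associator b d c - associator d c b + associator c b d \<noteq> cd_zero n"

datatype nonassoc_type = A | B | C | X

fun has_nonassoc_type :: "nat \<Rightarrow> cd \<Rightarrow> cd \<Rightarrow> cd \<Rightarrow> nonassoc_type \<Rightarrow> bool" where
  "has_nonassoc_type n b c d A \<longleftrightarrow> nonassoc_triad n b c d \<and>
     associator b d c \<noteq> cd_zero n \<and> associator b c d = cd_zero n \<and> associator c b d = cd_zero n"
| "has_nonassoc_type n b c d B \<longleftrightarrow> nonassoc_triad n b c d \<and>
     associator b d c = cd_zero n \<and> associator b c d \<noteq> cd_zero n \<and> associator c b d = cd_zero n"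
| "has_nonassoc_type n b c d C \<longleftrightarrow> nonassoc_triad n b c d \<and>
     associator b d c = cd_zero n \<and> associator b c d = cd_zero n \<and> associator c b d \<noteq> cd_zero n"
| "has_nonassoc_type n b c d X \<longleftrightarrow> nonassoc_triad n b c d \<and>
     associator b d c \<noteq> cd_zero n \<and> associator b c d \<noteq> cd_zero n \<and> associator c b d \<noteq> cd_zero n"

text \<open>Here \<open>e\<close> is the product \<open>bc\<close> read as a basis element, that is, up to sign.\<close>

definition three_triad_cycle :: "nat \<Rightarrow> cd \<Rightarrow> cd \<Rightarrow> cd \<Rightarrow> cd \<Rightarrow> bool" where
  "three_triad_cycle n b c e d \<longleftrightarrow>
     b \<in> pure_basis n \<and> c \<in> pure_basis n \<and> e \<in> pure_basis n \<and> d \<in> pure_basis n \<and>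
     (b * c = e \<or> b * c = - e) \<and>
     basis_less n b c \<and> basis_less n c e \<and> basis_less n e d"

definition cycle_word ::
  "nat \<Rightarrow> cd \<Rightarrow> cd \<Rightarrow> cd \<Rightarrow> cd \<Rightarrow> nonassoc_type list \<Rightarrow> bool" where
  "cycle_word n b c e d W \<longleftrightarrow>
     (\<exists>T1 T2 T3. W = [T1, T2, T3] \<and>
        has_nonassoc_type n b c d T1 \<and>
        has_nonassoc_type n b e d T2 \<and>
        has_nonassoc_type n c e d T3)"

definition allowed_words :: "nonassoc_type list set" where
  "allowed_words =
     {[A, A, A], [A, C, C], [X, B, B], [B, B, A], [B, X, C], [C, A, B], [C, C, X], [X, X, X]}"

end

theory Submission
  imports Defs
begin

text \<open>
  Products of basis elements are basis elements up to a sign \<open>cd_sign\<close>, so whether an associator of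
  basis elements vanishes is an identity between four signs. Only two properties of the signs
  matter: distinct pure basis elements anticommute, and \<open>x(xy) = (xx)y\<close> on basis elements.
  Anticommutativity alone expresses the three associators of an independent triad through three
  signs \<open>P\<close>, \<open>Q\<close>, \<open>R\<close> as \<open>P + Q\<close>, \<open>R - Q\<close>, \<open>P - R\<close>, up to the common basis element; hence an odd
  number of them is non-zero, the triad is non-associative and has a type. The second property
  says that \<open>[x, y, z]\<close> and \<open>[x, xy, z]\<close> vanish simultaneously, which identifies the second
  associator of the first triad with that of the second, the third of the first with the second of
  the third, and the third of the second with the third of the third. Together with the oddness of
  each triad these identifications leave eight words. The witnesses realising them were
  found by a computer search over small \<open>n\<close>.
\<close>

subsection \<open>Scalar multiples of basis elements\<close>

text \<open>Sums of trees of different shape are unspecified, so \<open>cd\<close> as a whole is no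
  real vector space. Scaling as a plain recursion is total, and negation becomes scaling by
  -1.\<close>

primrec cd_scale :: "real \<Rightarrow> cd \<Rightarrow> cd" where
  "cd_scale r (Re a) = Re (r * a)"
| "cd_scale r (Pr x y) = Pr (cd_scale r x) (cd_scale r y)"

lemma cd_scale_in_cd_algebra [simp]: "x \<in> cd_algebra n \<Longrightarrow> cd_scale r x \<in> cd_algebra n"
  by (induction n arbitrary: x) auto

lemma cd_scale_one [simp]: "cd_scale 1 x = x"
  by (induction x) simp_all

lemma cd_scale_scale [simp]: "cd_scale r (cd_scale s x) = cd_scale (r * s) x"
  by (induction x) simp_all

lemma uminus_cd_eq_scale: "- x = cd_scale (- 1) x" for x :: cd
  by (induction x) simp_all

lemma cd_scale_add_left:
  "cd_scale r x + cd_scale s x = cd_scale (r + s) x"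
  by (induction x) (simp_all add: algebra_simps)

lemma cd_scale_diff_left:
  "cd_scale r x - cd_scale s x = cd_scale (r - s) x"
  by (simp add: minus_cd_def uminus_cd_eq_scale cd_scale_add_left)

lemma cd_scale_add_right:
  assumes "x \<in> cd_algebra n" "y \<in> cd_algebra n"
  shows "cd_scale r (x + y) = cd_scale r x + cd_scale r y"
  using assms by (induction n arbitrary: x y) (auto simp: algebra_simps)

lemma cd_scale_zero [simp]: "cd_scale r (cd_zero n) = cd_zero n"
  by (induction n) simp_all

lemma uminus_cd_zero [simp]: "- cd_zero n = cd_zero n"
  by (simp add: uminus_cd_eq_scale)

lemma cd_conj_scale: "cd_conj (cd_scale r x) = cd_scale r (cd_conj x)"
  by (induction x) (simp_all add: uminus_cd_eq_scale)

text \<open>Both equations go through one induction: the doubled product reverses some factors, so a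
  scalar on one side reappears on the other side one level down.\<close>

lemma times_cd_scale:
  assumes "x \<in> cd_algebra n" "y \<in> cd_algebra n"
  shows "cd_scale r x * y = cd_scale r (x * y)" "x * cd_scale r y = cd_scale r (x * y)"
  using assms
proof (induction n arbitrary: x y)
  case 0
  {
    case 1
    then show ?case by auto
  next
    case 2
    then show ?case by auto
  }
next
  case (Suc n)
  note alg = cd_scale_add_right[where n = n] times_in_cd_algebra uminus_in_cd_algebra
    cd_conj_in_cd_algebra
  {
    case 1
    then show ?case
      by (auto simp: minus_cd_def alg Suc.IH uminus_cd_eq_scale algebra_simps)
  next
    case 2
    then show ?case
      by (auto simp: minus_cd_def alg Suc.IH uminus_cd_eq_scale cd_conj_scale algebra_simps)
  }
qed

lemma cd_zero_add [simp]:
  assumes "x \<in> cd_algebra n"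
  shows "cd_zero n + x = x" "x + cd_zero n = x"
  using assms by (induction n arbitrary: x) auto

lemma cd_zero_diff [simp]:
  assumes "x \<in> cd_algebra n"
  shows "cd_zero n - x = - x" "x - cd_zero n = x"
  using assms by (simp_all add: minus_cd_def uminus_in_cd_algebra)

lemma cd_conj_zero [simp]: "cd_conj (cd_zero n) = cd_zero n"
  by (induction n) simp_all

lemma cd_zero_times [simp]:
  assumes "x \<in> cd_algebra n"
  shows "cd_zero n * x = cd_zero n" "x * cd_zero n = cd_zero n"
  using assms
  by (induction n arbitrary: x)
    (auto simp: cd_conj_in_cd_algebra cd_zero_in_algebra)

lemma cd_scale_basis_eq_zero: "cd_scale r (cd_basis n \<alpha>) = cd_zero n \<longleftrightarrow> r = 0"
  by (induction n arbitrary: \<alpha>) auto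

lemma subset_Suc_cases:
  assumes "\<alpha> \<subseteq> {1..Suc n}"
  obtains (old) "\<alpha> \<subseteq> {1..n}" "Suc n \<notin> \<alpha>"
    | (new) \<alpha>' where "\<alpha>' \<subseteq> {1..n}" "Suc n \<notin> \<alpha>'" "\<alpha> = insert (Suc n) \<alpha>'"
proof (cases "Suc n \<in> \<alpha>")
  case True
  with assms show ?thesis
    by (intro new[of "\<alpha> - {Suc n}"]) (auto simp: le_Suc_eq)
next
  case False
  with assms show ?thesis
    by (intro old) (auto simp: le_Suc_eq)
qed

text \<open>Membership of the top index decides which component of the tree is zero, and a non-zero
  \<open>r\<close> separates the two patterns. The scalar \<open>s\<close> is left free so that an
  unknown sign can be supplied.\<close>

lemma cd_scale_basis_inject:
  assumes "\<alpha> \<subseteq> {1..n}" "\<beta> \<subseteq> {1..n}" "r \<noteq> 0"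
    and "cd_scale r (cd_basis n \<alpha>) = cd_scale s (cd_basis n \<beta>)"
  shows "\<alpha> = \<beta>"
  using assms
proof (induction n arbitrary: \<alpha> \<beta>)
  case 0
  then show ?case by simp
next
  case (Suc n)
  have zero: "cd_zero n = cd_scale t (cd_basis n \<gamma>) \<longleftrightarrow> t = 0" for t \<gamma>
    by (metis cd_scale_basis_eq_zero)
  show ?case
    using Suc.prems(3,4)
    by (rule_tac subset_Suc_cases[OF Suc.prems(1)]; rule_tac subset_Suc_cases[OF Suc.prems(2)])
      (auto simp: cd_scale_basis_eq_zero zero dest: Suc.IH[simplified])
qed

subsection \<open>The sign of a product of basis elements\<close>

text \<open>Multiplication of basis elements acts on index sets as addition in an elementary abelian
  2-group. A constant of its own stays folded and permits rewriting by associativity and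
  commutativity.\<close>

definition symdiff :: "'a set \<Rightarrow> 'a set \<Rightarrow> 'a set" (infixl "\<triangle>" 65) where
  "\<alpha> \<triangle> \<beta> = sym_diff \<alpha> \<beta>"

lemma symdiff_assoc: "\<alpha> \<triangle> \<beta> \<triangle> \<gamma> = \<alpha> \<triangle> (\<beta> \<triangle> \<gamma>)"
  by (auto simp: symdiff_def)

lemma symdiff_commute: "\<alpha> \<triangle> \<beta> = \<beta> \<triangle> \<alpha>"
  by (auto simp: symdiff_def)

lemma symdiff_left_commute: "\<beta> \<triangle> (\<alpha> \<triangle> \<gamma>) = \<alpha> \<triangle> (\<beta> \<triangle> \<gamma>)"
  by (auto simp: symdiff_def)

lemmas symdiff_ac = symdiff_assoc symdiff_commute symdiff_left_commute

lemma symdiff_empty [simp]: "\<alpha> \<triangle> {} = \<alpha>" "{} \<triangle> \<alpha> = \<alpha>"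
  by (auto simp: symdiff_def)

lemma symdiff_cancel [simp]: "\<alpha> \<triangle> \<alpha> = {}" "\<alpha> \<triangle> (\<alpha> \<triangle> \<beta>) = \<beta>"
  by (auto simp: symdiff_def)

lemma symdiff_eq_iff [simp]:
  "\<alpha> \<triangle> \<beta> = {} \<longleftrightarrow> \<alpha> = \<beta>" "\<alpha> \<triangle> \<beta> = \<alpha> \<longleftrightarrow> \<beta> = {}" "\<alpha> = \<alpha> \<triangle> \<beta> \<longleftrightarrow> \<beta> = {}"
  by (auto simp: symdiff_def)

lemma symdiff_subset [simp]: "\<alpha> \<subseteq> S \<Longrightarrow> \<beta> \<subseteq> S \<Longrightarrow> \<alpha> \<triangle> \<beta> \<subseteq> S"
  by (auto simp: symdiff_def)

lemma symdiff_mem: "k \<in> \<alpha> \<triangle> \<beta> \<longleftrightarrow> (k \<in> \<alpha>) \<noteq> (k \<in> \<beta>)"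
  by (auto simp: symdiff_def)

lemma symdiff_insert:
  assumes "k \<notin> \<alpha>" "k \<notin> \<beta>"
  shows "insert k \<alpha> \<triangle> \<beta> = insert k (\<alpha> \<triangle> \<beta>)"
    and "\<alpha> \<triangle> insert k \<beta> = insert k (\<alpha> \<triangle> \<beta>)"
    and "insert k \<alpha> \<triangle> insert k \<beta> = \<alpha> \<triangle> \<beta>"
  using assms by (auto simp: symdiff_def)

definition conj_sign :: "nat set \<Rightarrow> real" where
  "conj_sign \<alpha> = (if \<alpha> = {} then 1 else - 1)"

text \<open>The branches read off the doubling formula on (x,0), (0,y) times (z,0), (0,w): the
  products xz, wx, yz* and -w*y explain the swapped arguments and each
  \<open>conj_sign\<close>.\<close>

primrec cd_sign :: "nat \<Rightarrow> nat set \<Rightarrow> nat set \<Rightarrow> real" where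
  "cd_sign 0 \<alpha> \<beta> = 1"
| "cd_sign (Suc n) \<alpha> \<beta> = (let \<alpha>' = \<alpha> - {Suc n}; \<beta>' = \<beta> - {Suc n} in
     if Suc n \<in> \<alpha>
     then if Suc n \<in> \<beta> then - conj_sign \<beta>' * cd_sign n \<beta>' \<alpha>' else conj_sign \<beta>' * cd_sign n \<alpha>' \<beta>'
     else if Suc n \<in> \<beta> then cd_sign n \<beta>' \<alpha>' else cd_sign n \<alpha>' \<beta>')"

lemma cd_conj_basis:
  "\<alpha> \<subseteq> {1..n} \<Longrightarrow> cd_conj (cd_basis n \<alpha>) = cd_scale (conj_sign \<alpha>) (cd_basis n \<alpha>)"
proof (induction n arbitrary: \<alpha>)
  case 0
  then show ?case by (simp add: conj_sign_def)
next
  case (Suc n)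
  from Suc.prems show ?case
    by (cases rule: subset_Suc_cases) (auto simp: Suc.IH conj_sign_def uminus_cd_eq_scale)
qed

lemma cd_basis_mult:
  assumes "\<alpha> \<subseteq> {1..n}" "\<beta> \<subseteq> {1..n}"
  shows "cd_basis n \<alpha> * cd_basis n \<beta> = cd_scale (cd_sign n \<alpha> \<beta>) (cd_basis n (\<alpha> \<triangle> \<beta>))"
  using assms
proof (induction n arbitrary: \<alpha> \<beta>)
  case 0
  then show ?case by simp
next
  case (Suc n)
  note simps = Let_def symdiff_insert symdiff_mem cd_basis_in_cd_algebra cd_zero_in_algebra Suc.IH
    cd_conj_basis times_cd_scale[where n = n] uminus_cd_eq_scale symdiff_commute
  show ?case
    by (rule subset_Suc_cases[OF Suc.prems(1)]; rule subset_Suc_cases[OF Suc.prems(2)])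
      (simp_all add: simps)
qed

lemma cd_sign_cases: "cd_sign n \<alpha> \<beta> = 1 \<or> cd_sign n \<alpha> \<beta> = - 1"
  by (induction n arbitrary: \<alpha> \<beta>) (auto simp: Let_def conj_sign_def)

lemma cd_sign_empty [simp]: "cd_sign n {} \<alpha> = 1" "cd_sign n \<alpha> {} = 1"
  by (induction n arbitrary: \<alpha>) (auto simp: Let_def conj_sign_def)

section \<open>Squares, anticommutativity and alternativity of basis elements\<close>

lemma cd_sign_same:
  "\<alpha> \<subseteq> {1..n} \<Longrightarrow> cd_sign n \<alpha> \<alpha> = conj_sign \<alpha>"
proof (induction n arbitrary: \<alpha>)
  case 0
  then show ?case by (simp add: conj_sign_def)
next
  case (Suc n)
  from Suc.prems show ?case
    by (cases rule: subset_Suc_cases) (auto simp: Suc.IH Let_def conj_sign_def)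
qed

text \<open>If only one set contains the top index, conjugation of the other factor, which is pure,
  gives the sign. If both do, a remainder may be empty; the two conjugation signs then replace the
  induction hypothesis.\<close>

lemma cd_sign_anticommute:
  assumes "\<alpha> \<subseteq> {1..n}" "\<beta> \<subseteq> {1..n}" "\<alpha> \<noteq> {}" "\<beta> \<noteq> {}" "\<alpha> \<noteq> \<beta>"
  shows "cd_sign n \<beta> \<alpha> = - cd_sign n \<alpha> \<beta>"
  using assms
proof (induction n arbitrary: \<alpha> \<beta>)
  case 0
  then show ?case by simp
next
  case (Suc n)
  show ?case
    using Suc.prems(1)
  proof (cases rule: subset_Suc_cases)
    case old
    note \<alpha> = this
    from Suc.prems(2) show ?thesis
    proof (cases rule: subset_Suc_cases)
      case old
      then show ?thesis
        using \<alpha> Suc.prems(3-) by (simp add: Suc.IH[of \<alpha> \<beta>])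
    next
      case (new \<beta>')
      then show ?thesis
        using \<alpha> Suc.prems(3-) by (simp add: conj_sign_def)
    qed
  next
    case (new \<alpha>')
    note \<alpha> = this
    from Suc.prems(2) show ?thesis
    proof (cases rule: subset_Suc_cases)
      case old
      then show ?thesis
        using \<alpha> Suc.prems(3-) by (simp add: conj_sign_def)
    next
      case (new \<beta>')
      then have "\<alpha>' \<noteq> \<beta>'"
        using \<alpha> Suc.prems(5) by auto
      then show ?thesis
        using \<alpha> new Suc.IH[of \<alpha>' \<beta>'] by (cases "\<alpha>' = {} \<or> \<beta>' = {}") (auto simp: conj_sign_def)
    qed
  qed
qed

text \<open>Doubling turns the left alternative law into a right law and two laws twisted by
  conjugation. In the generic case each follows from \<open>alt\<close> by anticommuting factors;
  the coincidences among \<open>{}\<close>, \<open>\<alpha>\<close> and \<open>\<beta>\<close> are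
  direct.\<close>

lemma cd_sign_alternative_aux:
  assumes sub: "\<alpha> \<subseteq> {1..n}" "\<beta> \<subseteq> {1..n}"
    and alt: "cd_sign n \<alpha> \<beta> * cd_sign n \<alpha> (\<alpha> \<triangle> \<beta>) = conj_sign \<alpha>"
  shows "cd_sign n \<beta> \<alpha> * cd_sign n (\<alpha> \<triangle> \<beta>) \<alpha> = conj_sign \<alpha>"
    and "conj_sign \<beta> * cd_sign n \<alpha> \<beta> * (conj_sign (\<alpha> \<triangle> \<beta>) * cd_sign n (\<alpha> \<triangle> \<beta>) \<alpha>) = 1"
    and "conj_sign \<beta> * cd_sign n \<beta> \<alpha> * (conj_sign (\<alpha> \<triangle> \<beta>) * cd_sign n \<alpha> (\<alpha> \<triangle> \<beta>)) = 1"
proof -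
  consider "\<alpha> = {}" | "\<beta> = {}" | "\<alpha> \<noteq> {}" "\<alpha> = \<beta>" | "\<alpha> \<noteq> {}" "\<beta> \<noteq> {}" "\<alpha> \<noteq> \<beta>"
    by blast
  then have "cd_sign n \<beta> \<alpha> * cd_sign n (\<alpha> \<triangle> \<beta>) \<alpha> = conj_sign \<alpha> \<and>
    conj_sign \<beta> * cd_sign n \<alpha> \<beta> * (conj_sign (\<alpha> \<triangle> \<beta>) * cd_sign n (\<alpha> \<triangle> \<beta>) \<alpha>) = 1 \<and>
    conj_sign \<beta> * cd_sign n \<beta> \<alpha> * (conj_sign (\<alpha> \<triangle> \<beta>) * cd_sign n \<alpha> (\<alpha> \<triangle> \<beta>)) = 1"
  proof cases
    case 4
    then show ?thesis
      using alt sub cd_sign_anticommute[of \<alpha> n \<beta>] cd_sign_anticommute[of \<alpha> n "\<alpha> \<triangle> \<beta>"]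
      by (simp add: conj_sign_def)
  qed (use sub in \<open>auto simp: cd_sign_same conj_sign_def\<close>)
  then show "cd_sign n \<beta> \<alpha> * cd_sign n (\<alpha> \<triangle> \<beta>) \<alpha> = conj_sign \<alpha>"
    and "conj_sign \<beta> * cd_sign n \<alpha> \<beta> * (conj_sign (\<alpha> \<triangle> \<beta>) * cd_sign n (\<alpha> \<triangle> \<beta>) \<alpha>) = 1"
    and "conj_sign \<beta> * cd_sign n \<beta> \<alpha> * (conj_sign (\<alpha> \<triangle> \<beta>) * cd_sign n \<alpha> (\<alpha> \<triangle> \<beta>)) = 1"
    by simp_all
qed

text \<open>This is x(xy) = (xx)y on basis elements, \<open>conj_sign \<alpha>\<close> being the
  sign of the square. It holds for all n, although the algebras themselves are not alternative from
  n = 4 on.\<close>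

lemma cd_sign_alternative:
  assumes "\<alpha> \<subseteq> {1..n}" "\<beta> \<subseteq> {1..n}"
  shows "cd_sign n \<alpha> \<beta> * cd_sign n \<alpha> (\<alpha> \<triangle> \<beta>) = conj_sign \<alpha>"
  using assms
proof (induction n arbitrary: \<alpha> \<beta>)
  case 0
  then show ?case by (simp add: conj_sign_def)
next
  case (Suc n)
  note aux = cd_sign_alternative_aux[OF _ _ Suc.IH]
  show ?case
    \<comment> \<open>Neither set new: induction hypothesis. Only \<open>\<beta>\<close> new, only
      \<open>\<alpha>\<close> new, both new: the first, second and third conclusion of the auxiliary
      lemma.\<close>
    by (rule subset_Suc_cases[OF Suc.prems(1)]; rule subset_Suc_cases[OF Suc.prems(2)])
      (simp_all add: Let_def symdiff_mem symdiff_insert Suc.IH aux conj_sign_def[of "insert _ _"])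
qed

subsection \<open>Associators of basis elements\<close>

lemma associator_basis:
  assumes "\<alpha> \<subseteq> {1..n}" "\<beta> \<subseteq> {1..n}" "\<gamma> \<subseteq> {1..n}"
  shows "associator (cd_basis n \<alpha>) (cd_basis n \<beta>) (cd_basis n \<gamma>) =
    cd_scale (cd_sign n \<alpha> \<beta> * cd_sign n (\<alpha> \<triangle> \<beta>) \<gamma> - cd_sign n \<beta> \<gamma> * cd_sign n \<alpha> (\<beta> \<triangle> \<gamma>))
      (cd_basis n (\<alpha> \<triangle> \<beta> \<triangle> \<gamma>))"
  using assms
  by (simp add: associator_def cd_basis_mult times_cd_scale[where n = n] cd_basis_in_cd_algebra
      cd_scale_diff_left symdiff_assoc)

lemma associator_basis_eq_zero_iff:
  assumes "\<alpha> \<subseteq> {1..n}" "\<beta> \<subseteq> {1..n}" "\<gamma> \<subseteq> {1..n}"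
  shows "associator (cd_basis n \<alpha>) (cd_basis n \<beta>) (cd_basis n \<gamma>) = cd_zero n \<longleftrightarrow>
    cd_sign n \<alpha> \<beta> * cd_sign n (\<alpha> \<triangle> \<beta>) \<gamma> = cd_sign n \<beta> \<gamma> * cd_sign n \<alpha> (\<beta> \<triangle> \<gamma>)"
  using assms by (simp add: associator_basis cd_scale_basis_eq_zero)

text \<open>Either associator vanishes exactly when the product of the same four signs is 1: by
  \<open>cd_sign_alternative\<close>, passing from y to xy changes the two signs with left factor x
  by the common factor \<open>conj_sign \<alpha>\<close>.\<close>

lemma associator_basis_symdiff_eq_zero_iff:
  assumes sub: "\<alpha> \<subseteq> {1..n}" "\<beta> \<subseteq> {1..n}" "\<gamma> \<subseteq> {1..n}"
  shows "associator (cd_basis n \<alpha>) (cd_basis n (\<alpha> \<triangle> \<beta>)) (cd_basis n \<gamma>) = cd_zero n \<longleftrightarrow>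
    associator (cd_basis n \<alpha>) (cd_basis n \<beta>) (cd_basis n \<gamma>) = cd_zero n"
proof -
  have "cd_sign n \<alpha> (\<alpha> \<triangle> \<beta>) = conj_sign \<alpha> * cd_sign n \<alpha> \<beta>"
    and "cd_sign n \<alpha> (\<alpha> \<triangle> (\<beta> \<triangle> \<gamma>)) = conj_sign \<alpha> * cd_sign n \<alpha> (\<beta> \<triangle> \<gamma>)"
    using cd_sign_alternative[of \<alpha> n \<beta>] cd_sign_alternative[of \<alpha> n "\<beta> \<triangle> \<gamma>"] sub
      cd_sign_cases[of n \<alpha> \<beta>] cd_sign_cases[of n \<alpha> "\<beta> \<triangle> \<gamma>"]
    by auto
  then show ?thesis
    using sub cd_sign_cases[of n \<alpha> \<beta>] cd_sign_cases[of n \<alpha> "\<beta> \<triangle> \<gamma>"]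
      cd_sign_cases[of n "\<alpha> \<triangle> \<beta>" \<gamma>] cd_sign_cases[of n \<beta> \<gamma>]
    by (auto simp: associator_basis_eq_zero_iff symdiff_assoc conj_sign_def)
qed

text \<open>\<open>P\<close>, \<open>Q\<close>, \<open>R\<close> are the signs of (bd)c, b(cd) and
  (bc)d. Two-valued signs allow exactly four patterns of agreement, one per type.\<close>

definition triad_type :: "nat \<Rightarrow> nat set \<Rightarrow> nat set \<Rightarrow> nat set \<Rightarrow> nonassoc_type" where
  "triad_type n \<beta> \<gamma> \<delta> =
    (let P = cd_sign n \<beta> \<delta> * cd_sign n (\<beta> \<triangle> \<delta>) \<gamma>;
         Q = cd_sign n \<gamma> \<delta> * cd_sign n \<beta> (\<gamma> \<triangle> \<delta>);
         R = cd_sign n \<beta> \<gamma> * cd_sign n (\<beta> \<triangle> \<gamma>) \<delta>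
     in if P = Q then (if Q = R then A else X) else (if Q = R then C else B))"

lemma triad_associators:
  assumes sub: "\<beta> \<subseteq> {1..n}" "\<gamma> \<subseteq> {1..n}" "\<delta> \<subseteq> {1..n}"
    and indep: "\<beta> \<noteq> {}" "\<gamma> \<noteq> {}" "\<delta> \<noteq> {}" "\<beta> \<noteq> \<gamma>" "\<beta> \<noteq> \<delta>" "\<gamma> \<noteq> \<delta>" "\<beta> \<triangle> \<gamma> \<noteq> \<delta>"
  defines "b \<equiv> cd_basis n \<beta>" and "c \<equiv> cd_basis n \<gamma>" and "d \<equiv> cd_basis n \<delta>"
  shows "associator b d c - associator d c b + associator c b d \<noteq> cd_zero n"
    and "associator b d c = cd_zero n \<longleftrightarrow> triad_type n \<beta> \<gamma> \<delta> \<in> {B, C}"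
    and "associator b c d = cd_zero n \<longleftrightarrow> triad_type n \<beta> \<gamma> \<delta> \<in> {A, C}"
    and "associator c b d = cd_zero n \<longleftrightarrow> triad_type n \<beta> \<gamma> \<delta> \<in> {A, B}"
proof -
  define P where "P = cd_sign n \<beta> \<delta> * cd_sign n (\<beta> \<triangle> \<delta>) \<gamma>"
  define Q where "Q = cd_sign n \<gamma> \<delta> * cd_sign n \<beta> (\<gamma> \<triangle> \<delta>)"
  define R where "R = cd_sign n \<beta> \<gamma> * cd_sign n (\<beta> \<triangle> \<gamma>) \<delta>"
  have signs: "P = 1 \<or> P = - 1" "Q = 1 \<or> Q = - 1" "R = 1 \<or> R = - 1"
    unfolding P_def Q_def R_def by (metis cd_sign_cases mult_1 mult_minus1 minus_minus)+
  \<comment> \<open>The products cd and bd must differ from the remaining factor in order to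
    anticommute with it.\<close>
  have ne: "\<gamma> \<triangle> \<delta> \<noteq> \<beta>" "\<beta> \<triangle> \<delta> \<noteq> \<gamma>"
    using indep(7) by (auto simp: symdiff_ac)
  have anti: "cd_sign n \<delta> \<gamma> = - cd_sign n \<gamma> \<delta>" "cd_sign n \<gamma> \<beta> = - cd_sign n \<beta> \<gamma>"
    "cd_sign n \<gamma> (\<beta> \<triangle> \<delta>) = - cd_sign n (\<beta> \<triangle> \<delta>) \<gamma>"
    "cd_sign n (\<gamma> \<triangle> \<delta>) \<beta> = - cd_sign n \<beta> (\<gamma> \<triangle> \<delta>)"
    "cd_sign n \<delta> (\<beta> \<triangle> \<gamma>) = - cd_sign n (\<beta> \<triangle> \<gamma>) \<delta>"
    by (rule cd_sign_anticommute; use sub indep ne in simp)+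
  define e where "e = cd_basis n (\<beta> \<triangle> (\<gamma> \<triangle> \<delta>))"
  have vals: "associator b d c = cd_scale (P + Q) e" "associator b c d = cd_scale (R - Q) e"
    "associator c b d = cd_scale (P - R) e" "associator d c b = cd_scale (Q - R) e"
    using sub anti unfolding b_def c_def d_def e_def P_def Q_def R_def
    by (simp_all add: associator_basis symdiff_ac)
  have type_eq: "triad_type n \<beta> \<gamma> \<delta> = (if P = Q then (if Q = R then A else X) else (if Q = R then C else B))"
    by (simp add: triad_type_def P_def Q_def R_def)
  have scale_e: "cd_scale r e = cd_zero n \<longleftrightarrow> r = 0" for r
    by (simp add: e_def cd_scale_basis_eq_zero)
  \<comment> \<open>The coefficients combine to (P + Q) - (Q - R) + (P - R) = 2P, which is
    non-zero.\<close>
  show "associator b d c - associator d c b + associator c b d \<noteq> cd_zero n"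
    using signs by (auto simp: vals cd_scale_diff_left cd_scale_add_left scale_e)
  show "associator b d c = cd_zero n \<longleftrightarrow> triad_type n \<beta> \<gamma> \<delta> \<in> {B, C}"
    and "associator b c d = cd_zero n \<longleftrightarrow> triad_type n \<beta> \<gamma> \<delta> \<in> {A, C}"
    and "associator c b d = cd_zero n \<longleftrightarrow> triad_type n \<beta> \<gamma> \<delta> \<in> {A, B}"
    using signs by (auto simp: vals scale_e type_eq)
qed

subsection \<open>The order on basis elements\<close>

lemma cd_basis_inject:
  assumes "\<alpha> \<subseteq> {1..n}" "\<beta> \<subseteq> {1..n}"
  shows "cd_basis n \<alpha> = cd_basis n \<beta> \<longleftrightarrow> \<alpha> = \<beta>"
  using cd_scale_basis_inject[OF assms, of 1 1] by auto

text \<open>The witness \<open>m\<close> is the largest element of the symmetric difference. Unlike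
  \<open>Max\<close>, this form needs no finiteness and makes transitivity direct.\<close>

definition set_less :: "nat set \<Rightarrow> nat set \<Rightarrow> bool" where
  "set_less \<alpha> \<beta> \<longleftrightarrow> (\<exists>m. m \<in> \<beta> \<and> m \<notin> \<alpha> \<and> (\<forall>i>m. i \<in> \<alpha> \<longleftrightarrow> i \<in> \<beta>))"

lemma set_less_irrefl: "\<not> set_less \<alpha> \<alpha>"
  by (auto simp: set_less_def)

lemma set_less_trans:
  assumes "set_less \<alpha> \<beta>" "set_less \<beta> \<gamma>"
  shows "set_less \<alpha> \<gamma>"
proof -
  obtain k where k: "k \<in> \<beta>" "k \<notin> \<alpha>" "\<And>i. i > k \<Longrightarrow> i \<in> \<alpha> \<longleftrightarrow> i \<in> \<beta>"
    using assms(1) by (auto simp: set_less_def)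
  obtain l where l: "l \<in> \<gamma>" "l \<notin> \<beta>" "\<And>i. i > l \<Longrightarrow> i \<in> \<beta> \<longleftrightarrow> i \<in> \<gamma>"
    using assms(2) by (auto simp: set_less_def)
  \<comment> \<open>\<open>k\<close> and \<open>l\<close> differ, since \<open>\<beta>\<close>
    contains \<open>k\<close> but not \<open>l\<close>; the larger one decides the
    comparison.\<close>
  have "max k l \<in> \<gamma> \<and> max k l \<notin> \<alpha> \<and> (\<forall>i>max k l. i \<in> \<alpha> \<longleftrightarrow> i \<in> \<gamma>)"
    using k l by (cases k l rule: linorder_cases) (auto simp: max_def)
  then show ?thesis
    by (auto simp: set_less_def)
qed

lemma set_less_iff_Max:
  assumes "finite \<alpha>" "finite \<beta>"
  shows "set_less \<alpha> \<beta> \<longleftrightarrow> \<alpha> \<triangle> \<beta> \<noteq> {} \<and> Max (\<alpha> \<triangle> \<beta>) \<in> \<beta>"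
proof
  assume "set_less \<alpha> \<beta>"
  then obtain m where m: "m \<in> \<beta>" "m \<notin> \<alpha>" "\<And>i. i > m \<Longrightarrow> i \<in> \<alpha> \<longleftrightarrow> i \<in> \<beta>"
    by (auto simp: set_less_def)
  have "finite (\<alpha> \<triangle> \<beta>)"
    using assms by (simp add: symdiff_def)
  then have "Max (\<alpha> \<triangle> \<beta>) = m"
    using m by (intro Max_eqI) (auto simp: symdiff_mem intro: leI)
  with m show "\<alpha> \<triangle> \<beta> \<noteq> {} \<and> Max (\<alpha> \<triangle> \<beta>) \<in> \<beta>"
    by auto
next
  assume *: "\<alpha> \<triangle> \<beta> \<noteq> {} \<and> Max (\<alpha> \<triangle> \<beta>) \<in> \<beta>"
  have fin: "finite (\<alpha> \<triangle> \<beta>)"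
    using assms by (simp add: symdiff_def)
  then have "Max (\<alpha> \<triangle> \<beta>) \<in> \<alpha> \<triangle> \<beta>"
    using * by (intro Max_in) auto
  moreover have "i \<in> \<alpha> \<longleftrightarrow> i \<in> \<beta>" if "i > Max (\<alpha> \<triangle> \<beta>)" for i
    using Max_ge[OF fin, of i] that by (auto simp: symdiff_mem)
  ultimately show "set_less \<alpha> \<beta>"
    using * by (auto simp: set_less_def symdiff_mem)
qed

lemma basis_less_iff:
  assumes "\<alpha> \<subseteq> {1..n}" "\<beta> \<subseteq> {1..n}"
  shows "basis_less n (cd_basis n \<alpha>) (cd_basis n \<beta>) \<longleftrightarrow> set_less \<alpha> \<beta>"
proof -
  have "finite \<alpha>" "finite \<beta>"
    using assms finite_subset by blast+
  then show ?thesis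
    using assms unfolding basis_less_def set_less_iff_Max[OF \<open>finite \<alpha>\<close> \<open>finite \<beta>\<close>]
    by (metis cd_basis_inject symdiff_def symdiff_eq_iff(1))
qed

lemma pure_basis_iff:
  assumes "\<alpha> \<subseteq> {1..n}"
  shows "cd_basis n \<alpha> \<in> pure_basis n \<longleftrightarrow> \<alpha> \<noteq> {}"
  using assms by (auto simp: pure_basis_def cd_basis_inject)

subsection \<open>Words of cycles\<close>

definition basis_cycle :: "nat \<Rightarrow> nat set \<Rightarrow> nat set \<Rightarrow> nat set \<Rightarrow> bool" where
  "basis_cycle n \<beta> \<gamma> \<delta> \<longleftrightarrow> \<beta> \<subseteq> {1..n} \<and> \<gamma> \<subseteq> {1..n} \<and> \<delta> \<subseteq> {1..n} \<and> \<beta> \<noteq> {} \<and> \<gamma> \<noteq> {} \<and> \<delta> \<noteq> {} \<and>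
    set_less \<beta> \<gamma> \<and> set_less \<gamma> (\<beta> \<triangle> \<gamma>) \<and> set_less (\<beta> \<triangle> \<gamma>) \<delta>"

lemma three_triad_cycle_obtains:
  assumes "three_triad_cycle n b c e d"
  obtains \<beta> \<gamma> \<delta> where "b = cd_basis n \<beta>" "c = cd_basis n \<gamma>" "e = cd_basis n (\<beta> \<triangle> \<gamma>)"
    "d = cd_basis n \<delta>" "basis_cycle n \<beta> \<gamma> \<delta>"
proof -
  obtain \<beta> \<gamma> \<epsilon> \<delta> where eq: "b = cd_basis n \<beta>" "c = cd_basis n \<gamma>" "e = cd_basis n \<epsilon>" "d = cd_basis n \<delta>"
    and sub: "\<beta> \<subseteq> {1..n}" "\<gamma> \<subseteq> {1..n}" "\<epsilon> \<subseteq> {1..n}" "\<delta> \<subseteq> {1..n}" and ne: "\<beta> \<noteq> {}" "\<gamma> \<noteq> {}" "\<delta> \<noteq> {}"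
    using assms unfolding three_triad_cycle_def pure_basis_def by blast
  \<comment> \<open>The sign relating bc to e stays anonymous; injectivity for scaled basis elements
    still recovers the index set of e.\<close>
  have "\<exists>s. cd_scale (cd_sign n \<beta> \<gamma>) (cd_basis n (\<beta> \<triangle> \<gamma>)) = cd_scale s (cd_basis n \<epsilon>)"
    using assms sub unfolding three_triad_cycle_def eq uminus_cd_eq_scale
    by (metis cd_basis_mult cd_scale_one)
  moreover have "cd_sign n \<beta> \<gamma> \<noteq> 0"
    using cd_sign_cases[of n \<beta> \<gamma>] by auto
  ultimately have "\<epsilon> = \<beta> \<triangle> \<gamma>"
    using cd_scale_basis_inject sub by (metis symdiff_subset)
  with assms eq sub ne that[of \<beta> \<gamma> \<delta>] show ?thesis
    by (simp add: three_triad_cycle_def basis_cycle_def basis_less_iff)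
qed

text \<open>The order makes the three sets distinct, hence independent by the last hypothesis.
  Solving for \<open>T\<close> gives existence and uniqueness of the type together.\<close>

lemma has_nonassoc_type_basis_iff:
  assumes sub: "\<beta> \<subseteq> {1..n}" "\<gamma> \<subseteq> {1..n}" "\<delta> \<subseteq> {1..n}"
    and less: "\<beta> \<noteq> {}" "\<gamma> \<noteq> {}" "\<delta> \<noteq> {}" "set_less \<beta> \<gamma>" "set_less \<gamma> \<delta>" "\<beta> \<triangle> \<gamma> \<noteq> \<delta>"
  shows "has_nonassoc_type n (cd_basis n \<beta>) (cd_basis n \<gamma>) (cd_basis n \<delta>) T \<longleftrightarrow>
    T = triad_type n \<beta> \<gamma> \<delta>"
proof -
  have indep: "\<beta> \<noteq> \<gamma>" "\<beta> \<noteq> \<delta>" "\<gamma> \<noteq> \<delta>"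
    using less set_less_irrefl set_less_trans by metis+
  note assoc = triad_associators[OF sub less(1-3) indep less(6)]
  have "nonassoc_triad n (cd_basis n \<beta>) (cd_basis n \<gamma>) (cd_basis n \<delta>)"
    using sub less assoc(1) by (simp add: nonassoc_triad_def triad_def pure_basis_iff basis_less_iff)
  then show ?thesis
    by (cases T; cases "triad_type n \<beta> \<gamma> \<delta>") (simp_all add: assoc(2-4))
qed

lemma basis_cycle_word:
  assumes "basis_cycle n \<beta> \<gamma> \<delta>"
  defines "\<epsilon> \<equiv> \<beta> \<triangle> \<gamma>"
  shows "cycle_word n (cd_basis n \<beta>) (cd_basis n \<gamma>) (cd_basis n \<epsilon>) (cd_basis n \<delta>) W \<longleftrightarrow>
      W = [triad_type n \<beta> \<gamma> \<delta>, triad_type n \<beta> \<epsilon> \<delta>, triad_type n \<gamma> \<epsilon> \<delta>]" (is ?word)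
    and "three_triad_cycle n (cd_basis n \<beta>) (cd_basis n \<gamma>) (cd_basis n \<epsilon>) (cd_basis n \<delta>)" (is ?cycle)
    and "[triad_type n \<beta> \<gamma> \<delta>, triad_type n \<beta> \<epsilon> \<delta>, triad_type n \<gamma> \<epsilon> \<delta>] \<in> allowed_words" (is ?allowed)
proof -
  have sub: "\<beta> \<subseteq> {1..n}" "\<gamma> \<subseteq> {1..n}" "\<delta> \<subseteq> {1..n}" "\<epsilon> \<subseteq> {1..n}"
    and ne: "\<beta> \<noteq> {}" "\<gamma> \<noteq> {}" "\<delta> \<noteq> {}"
    and less: "set_less \<beta> \<gamma>" "set_less \<gamma> \<epsilon>" "set_less \<epsilon> \<delta>"
    using assms by (simp_all add: basis_cycle_def)
  have less': "set_less \<beta> \<epsilon>" "set_less \<gamma> \<delta>" "set_less \<beta> \<delta>"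
    using less set_less_trans by metis+
  have indep: "\<beta> \<noteq> \<gamma>" "\<beta> \<noteq> \<epsilon>" "\<beta> \<noteq> \<delta>" "\<gamma> \<noteq> \<epsilon>" "\<gamma> \<noteq> \<delta>" "\<epsilon> \<noteq> \<delta>"
    using less less' set_less_irrefl by metis+
  have ne\<epsilon>: "\<epsilon> \<noteq> {}"
    using indep(1) by (simp add: \<epsilon>_def)
  \<comment> \<open>Any two of the three sets have the third as symmetric difference, so
    independence from \<open>\<delta>\<close> reduces to distinctness, and the alternative law can
    link the triads.\<close>
  have sums: "\<beta> \<triangle> \<gamma> = \<epsilon>" "\<beta> \<triangle> \<epsilon> = \<gamma>" "\<gamma> \<triangle> \<epsilon> = \<beta>" "\<epsilon> \<triangle> \<beta> = \<gamma>" "\<epsilon> \<triangle> \<gamma> = \<beta>"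
    by (simp_all add: \<epsilon>_def symdiff_ac)
  show ?word
    using sub ne ne\<epsilon> less less' indep
    by (auto simp: cycle_word_def has_nonassoc_type_basis_iff sums)
  have "cd_basis n \<beta> * cd_basis n \<gamma> = cd_basis n \<epsilon> \<or> cd_basis n \<beta> * cd_basis n \<gamma> = - cd_basis n \<epsilon>"
    using cd_sign_cases[of n \<beta> \<gamma>] sub by (auto simp: cd_basis_mult sums uminus_cd_eq_scale)
  then show ?cycle
    using sub ne ne\<epsilon> less by (simp add: three_triad_cycle_def pure_basis_iff basis_less_iff)
  note assoc = triad_associators(3,4)
  have "triad_type n \<beta> \<epsilon> \<delta> \<in> {A, C} \<longleftrightarrow> triad_type n \<beta> \<gamma> \<delta> \<in> {A, C}"
    using associator_basis_symdiff_eq_zero_iff[of \<beta> n \<gamma> \<delta>] sub ne ne\<epsilon> indep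
    by (simp add: assoc[symmetric] sums del: insert_iff)
  \<comment> \<open>Since cb is e up to sign, [c, b, d] and [c, e, d] vanish together.\<close>
  moreover have "triad_type n \<gamma> \<epsilon> \<delta> \<in> {A, C} \<longleftrightarrow> triad_type n \<beta> \<gamma> \<delta> \<in> {A, B}"
    using associator_basis_symdiff_eq_zero_iff[of \<gamma> n \<beta> \<delta>] sub ne ne\<epsilon> indep
    by (simp add: assoc[symmetric] sums symdiff_commute[of \<gamma> \<beta>] del: insert_iff)
  \<comment> \<open>Since eb is c up to sign, [e, b, d] and [e, c, d] vanish together.\<close>
  moreover have "triad_type n \<gamma> \<epsilon> \<delta> \<in> {A, B} \<longleftrightarrow> triad_type n \<beta> \<epsilon> \<delta> \<in> {A, B}"
    using associator_basis_symdiff_eq_zero_iff[of \<epsilon> n \<beta> \<delta>] sub ne ne\<epsilon> indep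
    by (simp add: assoc[symmetric] sums del: insert_iff)
  \<comment> \<open>Vanishing of the second and third associators determines a type. The six
    conditions for the three triads are identified in pairs, leaving three truth values and hence
    eight words.\<close>
  ultimately show ?allowed
    by (cases "triad_type n \<beta> \<gamma> \<delta>"; cases "triad_type n \<beta> \<epsilon> \<delta>"; cases "triad_type n \<gamma> \<epsilon> \<delta>")
      (simp_all add: allowed_words_def)
qed

section \<open>Explicit cycles realising the eight words\<close>

lemma basis_cycle_realises:
  assumes "n \<ge> 3" "basis_cycle n \<beta> \<gamma> \<delta>"
    and "[triad_type n \<beta> \<gamma> \<delta>, triad_type n \<beta> (\<beta> \<triangle> \<gamma>) \<delta>, triad_type n \<gamma> (\<beta> \<triangle> \<gamma>) \<delta>] = W"
  shows "\<exists>n\<ge>3. \<exists>b c e d. three_triad_cycle n b c e d \<and> cycle_word n b c e d W"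
  using assms(1) basis_cycle_word(2)[OF assms(2)]
    basis_cycle_word(1)[OF assms(2), THEN iffD2, OF assms(3)[symmetric]]
  by (intro exI conjI)

lemma cd_sign_numeral:
  "cd_sign (numeral k) \<alpha> \<beta> = (let n = pred_numeral k; \<alpha>' = \<alpha> - {numeral k}; \<beta>' = \<beta> - {numeral k} in
     if numeral k \<in> \<alpha>
     then if numeral k \<in> \<beta> then - conj_sign \<beta>' * cd_sign n \<beta>' \<alpha>' else conj_sign \<beta>' * cd_sign n \<alpha>' \<beta>'
     else if numeral k \<in> \<beta> then cd_sign n \<beta>' \<alpha>' else cd_sign n \<alpha>' \<beta>')"
  by (simp only: numeral_eq_Suc cd_sign.simps Let_def)

text \<open>\<open>set_less_iff_Max\<close> trades the unbounded quantifier of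
  \<open>set_less\<close> for the maximum of an explicit finite set, which simplification can
  compute.\<close>

lemmas eval_cycle = basis_cycle_def set_less_iff_Max triad_type_def symdiff_def conj_sign_def
  cd_sign_numeral insert_Diff_if Let_def

lemma allowed_words_realised:
  assumes "W \<in> allowed_words"
  shows "\<exists>n\<ge>3. \<exists>b c e d. three_triad_cycle n b c e d \<and> cycle_word n b c e d W"
proof -
  consider "W = [A, A, A]" | "W = [A, C, C]" | "W = [X, B, B]" |
    "W = [B, B, A]" | "W = [B, X, C]" | "W = [C, A, B]" | "W = [C, C, X]" | "W = [X, X, X]"
    using assms by (auto simp: allowed_words_def)
  then show ?thesis
  proof cases
    case 1
    show ?thesis
      unfolding \<open>W = [A, A, A]\<close>
      by (rule basis_cycle_realises[of 4 "{1}" "{2}" "{3, 4}"]) (simp_all add: eval_cycle)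
  next
    case 2
    show ?thesis
      unfolding \<open>W = [A, C, C]\<close>
      by (rule basis_cycle_realises[of 5 "{1, 4}" "{2, 5}" "{3, 4, 5}"]) (simp_all add: eval_cycle)
  next
    case 3
    show ?thesis
      unfolding \<open>W = [X, B, B]\<close>
      by (rule basis_cycle_realises[of 6 "{2, 4}" "{1, 2, 5}" "{3, 6}"]) (simp_all add: eval_cycle)
  next
    case 4
    show ?thesis
      unfolding \<open>W = [B, B, A]\<close>
      by (rule basis_cycle_realises[of 5 "{1}" "{2, 4}" "{3, 4, 5}"]) (simp_all add: eval_cycle)
  next
    case 5
    show ?thesis
      unfolding \<open>W = [B, X, C]\<close>
      by (rule basis_cycle_realises[of 6 "{1, 2, 4}" "{2, 5, 6}" "{3, 4, 5, 6}"]) (simp_all add: eval_cycle)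
  next
    case 6
    show ?thesis
      unfolding \<open>W = [C, A, B]\<close>
      by (rule basis_cycle_realises[of 7 "{1, 3, 5}" "{3, 4, 6}" "{2, 6, 7}"]) (simp_all add: eval_cycle)
  next
    case 7
    show ?thesis
      unfolding \<open>W = [C, C, X]\<close>
      by (rule basis_cycle_realises[of 4 "{1}" "{2, 4}" "{3, 4}"]) (simp_all add: eval_cycle)
  next
    case 8
    show ?thesis
      unfolding \<open>W = [X, X, X]\<close>
      \<comment> \<open>For n = 3 these are the octonions, which are alternative: the three
        associators of a triad agree up to sign, so only type X is possible.\<close>
      by (rule basis_cycle_realises[of 3 "{1}" "{2}" "{3}"]) (simp_all add: eval_cycle)
  qed
qed

theorem theorem7:
  shows "(\<forall>n\<ge>3. \<forall>b c e d. three_triad_cycle n b c e d \<longrightarrow>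
            (\<exists>!W. cycle_word n b c e d W) \<and>
            (\<forall>W. cycle_word n b c e d W \<longrightarrow> W \<in> allowed_words)) \<and>
         (\<forall>W\<in>allowed_words. \<exists>n\<ge>3. \<exists>b c e d.
            three_triad_cycle n b c e d \<and> cycle_word n b c e d W)"
proof (intro conjI allI impI)
  fix n b c e d
  assume "three_triad_cycle n b c e d"
  then obtain \<beta> \<gamma> \<delta> where "b = cd_basis n \<beta>" "c = cd_basis n \<gamma>" "e = cd_basis n (\<beta> \<triangle> \<gamma>)"
    "d = cd_basis n \<delta>" "basis_cycle n \<beta> \<gamma> \<delta>"
    by (rule three_triad_cycle_obtains)
  then show "\<exists>!W. cycle_word n b c e d W"
    and "\<And>W. cycle_word n b c e d W \<Longrightarrow> W \<in> allowed_words"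
    using basis_cycle_word(3) by (simp_all add: basis_cycle_word(1))
next
  show "\<forall>W\<in>allowed_words. \<exists>n\<ge>3. \<exists>b c e d. three_triad_cycle n b c e d \<and> cycle_word n b c e d W"
    by (blast intro: allowed_words_realised)
qed

end
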